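(* Let $\mu\in\mathbb{R}$, $\sigma>0$, $X\sim\mathrm{LN}(\mu,\sigma^2)$ and $k>0$. Then the characteristic function $\varphi(t)=\mathbb{E}[e^{itX}]$ of $X$ has the integral expression $$\varphi(t)=\frac{1}{2\pi i}\int_{k-i\infty}^{k+i\infty}\Gamma(s)\,e^{-\left(\mu+\ln|t|-\operatorname{sgn}(t)\,i\frac{\pi}{2}\right)s+\frac{\sigma^2}{2}s^2}\,ds,\qquad t\in\mathbb{R}\setminus\{0\}.$$
   Context: $X\sim\mathrm{LN}(\mu,\sigma^2)$ (lognormal, $\mu\in\mathbb{R}$, $\sigma>0$) means that $X$ is a positive random variable with density $f(x)=\frac{1}{\sqrt{2\pi}\,\sigma x}\exp\left[-\frac{(\ln x-\mu)^2}{2\sigma^2}\right]$, $x>0$. $\Gamma$ is the gamma function. The contour of integration is the vertical line $\operatorname{Re}(s)=k$, traversed upward. *)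

theory Defs
  imports "HOL-Probability.Probability"
begin

definition lognormal_density :: "real \<Rightarrow> real \<Rightarrow> real \<Rightarrow> real" where
  "lognormal_density \<mu> \<sigma> x =
     (if x > 0 then 1 / (sqrt (2 * pi) * \<sigma> * x) * exp (- (ln x - \<mu>)\<^sup>2 / (2 * \<sigma>\<^sup>2)) else 0)"

(* X ~ LN(\<mu>, \<sigma>^2); the second parameter here is \<sigma>, not its square. Since the density
   vanishes on the nonpositive reals, X > 0 holds almost surely. *)
definition lognormal_distributed :: "'a measure \<Rightarrow> ('a \<Rightarrow> real) \<Rightarrow> real \<Rightarrow> real \<Rightarrow> bool" where
  "lognormal_distributed M X \<mu> \<sigma> \<longleftrightarrow> distributed M lborel X (\<lambda>x. ennreal (lognormal_density \<mu> \<sigma> x))"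

(* Integration along the whole line Re s = k, traversed upward: with s = k + i y, ds = i dy.
   The integral is meaningful only for integrands satisfying vertical_line_integrable. *)
definition vertical_line_integrable :: "real \<Rightarrow> (complex \<Rightarrow> complex) \<Rightarrow> bool" where
  "vertical_line_integrable k f \<longleftrightarrow> integrable lborel (\<lambda>y. f (Complex k y))"

definition vertical_line_integral :: "real \<Rightarrow> (complex \<Rightarrow> complex) \<Rightarrow> complex" where
  "vertical_line_integral k f = \<i> * (\<integral>y. f (Complex k y) \<partial>lborel)"

end

theory Submission
  imports Defs
begin

text \<open>
  For \<open>Re z > 0\<close> insert \<open>\<Gamma>(s) z\<^sup>-\<^sup>s = \<integral>\<^sub>0\<^sup>\<infinity> v\<^sup>s\<^sup>-\<^sup>1 e\<^sup>-\<^sup>z\<^sup>v dv\<close> into the integral along \<open>Re s = k\<close> of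
  \<open>\<Gamma>(s) z\<^sup>-\<^sup>s exp (- \<mu> s + \<sigma>\<^sup>2 s\<^sup>2 / 2)\<close> and exchange the integrals: the integral in \<open>s\<close> becomes Gaussian
  and evaluates to the lognormal density, so the outcome is the Laplace transform \<open>E[e\<^sup>-\<^sup>z\<^sup>X]\<close>.
  Then let \<open>z\<close> tend to \<open>- \<i> t\<close> from the right half-plane. No Stirling estimate is needed for the
  limit: \<open>\<bar>\<Gamma>(s)\<bar> \<le> \<Gamma>(k)\<close> and \<open>\<bar>z\<^sup>-\<^sup>s\<bar> \<le> \<bar>t\<bar>\<^sup>-\<^sup>k e\<^sup>\<pi>\<^sup>\<bar>\<^sup>y\<^sup>\<bar>\<close> for \<open>s = k + \<i> y\<close>, which the factor
  \<open>exp (- \<sigma>\<^sup>2 y\<^sup>2 / 2)\<close> dominates.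
\<close>

section \<open>The Gamma integral with a complex scale parameter\<close>

text \<open>The integrand v^(s-1) e^(-z v) of the Gamma integral, extended by zero to v \<le> 0 so
  that it can be integrated over \<open>lborel\<close>. Merging both factors into one exponential
  reduces moduli and products to arithmetic of exponents.\<close>

definition gamma_kernel :: "complex \<Rightarrow> complex \<Rightarrow> real \<Rightarrow> complex" where
  "gamma_kernel s z v = indicator {0<..} v *\<^sub>R exp ((s - 1) * of_real (ln v) - z * of_real v)"

lemma borel_measurable_cexp [measurable]:
  "(exp :: complex \<Rightarrow> complex) \<in> borel_measurable borel"
  by (intro borel_measurable_continuous_onI continuous_intros)

lemma gamma_kernel_measurable [measurable]: "gamma_kernel s z \<in> borel_measurable borel"
  unfolding gamma_kernel_def[abs_def] by measurable

lemma norm_gamma_kernel: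
  "norm (gamma_kernel s z v) = indicator {0<..} v * exp ((Re s - 1) * ln v - Re z * v)"
  by (simp add: gamma_kernel_def)

text \<open>The modulus of a kernel is again a kernel, with real parameters, so integrals of moduli
  follow from the same Gamma formulas.\<close>

lemma of_real_norm_gamma_kernel:
  "of_real (norm (gamma_kernel s z v)) = gamma_kernel (of_real (Re s)) (of_real (Re z)) v"
  unfolding norm_gamma_kernel by (simp add: gamma_kernel_def scaleR_conv_of_real flip: exp_of_real)

text \<open>This is Euler's integral. Absolute integrability identifies its gauge integral with the
  Lebesgue integral, and Borel measurability of the kernel passes from the completed measure to
  \<open>lborel\<close>.\<close>

lemma has_bochner_integral_gamma_kernel_1:
  assumes "Re s > 0"
  shows "has_bochner_integral lborel (gamma_kernel s 1) (Gamma s)"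
proof -
  have eq: "complex_of_real v powr (s - 1) / of_real (exp v) = exp ((s - 1) * of_real (ln v) - 1 * of_real v)"
    if "v > 0" for v
    using that by (simp add: powr_def exp_diff Ln_of_real exp_of_real)
  have abs: "(\<lambda>v. exp ((s - 1) * of_real (ln v) - 1 * of_real v)) absolutely_integrable_on {0<..}"
    using absolutely_integrable_Gamma_integral'[OF assms]
    by (rule set_integrable_cong[THEN iffD1, rotated -1]) (auto simp: eq)
  hence int: "integrable lebesgue (gamma_kernel s 1)"
    unfolding set_integrable_def gamma_kernel_def[abs_def] .
  have "((\<lambda>v. exp ((s - 1) * of_real (ln v) - 1 * of_real v)) has_integral Gamma s) {0<..}"
    using Gamma_integral_complex'[OF assms]
    by (rule has_integral_eq[rotated]) (simp only: eq greaterThan_iff)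
  hence "(LINT v|lebesgue. gamma_kernel s 1 v) = Gamma s"
    using set_lebesgue_integral_eq_integral(2)[OF abs] 
    unfolding set_lebesgue_integral_def gamma_kernel_def[abs_def] by (simp add: integral_unique)
  with int show ?thesis
    by (simp add: has_bochner_integral_iff integrable_completion integral_completion)
qed

text \<open>Substitute c v for v: the Jacobian contributes 1/c, and the prefactor c^(-(s-1)) removes
  the power of c from the kernel.\<close>

lemma has_bochner_integral_gamma_kernel_real:
  assumes "Re s > 0" "c > 0"
  shows "has_bochner_integral lborel (gamma_kernel s (of_real c)) (Gamma s * exp (- s * of_real (ln c)))"
proof -
  have "has_bochner_integral lborel (\<lambda>v. gamma_kernel s 1 (0 + c * v)) (Gamma s /\<^sub>R \<bar>c\<bar>)"
    using has_bochner_integral_gamma_kernel_1[OF assms(1)] assms(2)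
    by (subst lborel_has_bochner_integral_real_affine_iff[symmetric]) auto
  hence "has_bochner_integral lborel (\<lambda>v. exp (- (s - 1) * of_real (ln c)) * gamma_kernel s 1 (0 + c * v))
           (exp (- (s - 1) * of_real (ln c)) * (Gamma s /\<^sub>R \<bar>c\<bar>))"
    by (rule has_bochner_integral_mult_right)
  also have "(\<lambda>v. exp (- (s - 1) * of_real (ln c)) * gamma_kernel s 1 (0 + c * v)) = gamma_kernel s (of_real c)"
    using assms(2)
    by (auto simp: gamma_kernel_def fun_eq_iff indicator_def zero_less_mult_iff ln_mult mult_exp_exp algebra_simps)
  also have "exp (- (s - 1) * of_real (ln c)) * (Gamma s /\<^sub>R \<bar>c\<bar>) = Gamma s * exp (- s * of_real (ln c))"
    using assms(2) by (simp add: algebra_simps exp_diff exp_minus exp_add exp_of_real scaleR_conv_of_real field_simps)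
  finally show ?thesis .
qed

text \<open>Gamma(s+n) is the rising factorial of s times Gamma(s), and that factorial over n! is
  (-1)^n times the binomial coefficient of -s. With x = c - z this turns the integrated n-th term of
  the expansion of e^(-z v) about c into the n-th term of the binomial series of (1 -
  x/c)^(-s).\<close>

lemma Gamma_shift_binomial_coefficient:
  fixes s x :: complex
  assumes "Re s > 0" "c > 0"
  shows "x ^ n / fact n * (Gamma (s + of_nat n) * exp (- (s + of_nat n) * of_real (ln c))) =
    Gamma s * exp (- s * of_real (ln c)) * ((- s gchoose n) * (- x / of_real c) ^ n)"
proof -
  have "s \<notin> \<int>\<^sub>\<le>\<^sub>0" using assms(1) by (auto elim!: nonpos_Ints_cases)
  hence "Gamma (s + of_nat n) = pochhammer s n * Gamma s"
    using assms(1) by (simp add: pochhammer_Gamma Gamma_eq_zero_iff)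
  moreover have "exp (- (s + of_nat n) * of_real (ln c)) = exp (- s * of_real (ln c)) / of_real c ^ n"
  proof -
    have "exp (of_nat n * of_real (ln c) :: complex) = of_real c ^ n"
      using assms(2) by (simp add: exp_of_nat_mult exp_of_real)
    thus ?thesis by (simp add: algebra_simps exp_diff)
  qed
  moreover have "(- 1) ^ n * (- x / of_real c) ^ n = (x / of_real c) ^ n"
    by (simp flip: power_mult_distrib)
  ultimately show ?thesis
    by (simp add: gbinomial_pochhammer power_divide mult_ac)
qed

text \<open>
  Expanding \<open>e\<^sup>-\<^sup>z\<^sup>v\<close> around a real centre \<open>c\<close> with \<open>\<bar>c - z\<bar> < c\<close> turns the integral into a binomial
  series for \<open>(z / c)\<^sup>-\<^sup>s\<close>; this replaces the rotation of the contour of the Gamma integral.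
\<close>

lemma has_bochner_integral_gamma_kernel:
  assumes s: "Re s > 0" and z: "Re z > 0"
  shows "has_bochner_integral lborel (gamma_kernel s z) (Gamma s * exp (- s * Ln z))"
proof -
  \<comment> \<open>Any c above |z|^2 / (2 Re z) satisfies |c - z| < c; this choice is twice that
    threshold and gives |c - z|^2 = c^2 - |z|^2.\<close>
  define c where "c = (norm z)\<^sup>2 / Re z"
  have "z \<noteq> 0" using z by auto
  hence c: "c > 0" using z by (simp add: c_def)
  have "(norm (of_real c - z))\<^sup>2 = c\<^sup>2 - 2 * c * Re z + (norm z)\<^sup>2"
    unfolding cmod_power2 by (simp add: power2_eq_square algebra_simps)
  also have "\<dots> < c\<^sup>2" using z \<open>z \<noteq> 0\<close> by (simp add: c_def)
  finally have less: "norm (of_real c - z) < c"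
    using c by (simp add: power2_less_imp_less)
  define x where "x = of_real c - z"
  \<comment> \<open>Terms of e^(-z v) = e^(-c v) e^(x v), with the power v^n absorbed by shifting s
    to s + n.\<close>
  define f where "f n v = x ^ n / fact n * gamma_kernel (s + of_nat n) (of_real c) v" for n v
  have fint: "has_bochner_integral lborel (f n) 
      (x ^ n / fact n * (Gamma (s + of_nat n) * exp (- (s + of_nat n) * of_real (ln c))))" for n
    unfolding f_def using has_bochner_integral_gamma_kernel_real[of "s + of_nat n" c] s c
    by (intro has_bochner_integral_mult_right) auto
  have fsums: "(\<lambda>n. f n v) sums gamma_kernel s z v" for v
  proof (cases "v > 0")
    case True
    have "f n v = exp ((s - 1) * of_real (ln v) - of_real c * of_real v) * ((x * of_real v) ^ n /\<^sub>R fact n)" for n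
    proof -
      have "exp (of_nat n * of_real (ln v) :: complex) = of_real v ^ n"
        using True by (simp add: exp_of_nat_mult exp_of_real)
      moreover have "(s + of_nat n - 1) * of_real (ln v) - of_real c * of_real v
         = of_nat n * of_real (ln v) + ((s - 1) * of_real (ln v) - of_real c * of_real v)"
        by (simp add: algebra_simps)
      ultimately have "exp ((s + of_nat n - 1) * of_real (ln v) - of_real c * of_real v) =
          of_real v ^ n * exp ((s - 1) * of_real (ln v) - of_real c * of_real v)"
        by (simp only: exp_add)
      thus ?thesis
        using True by (simp add: f_def gamma_kernel_def power_mult_distrib scaleR_conv_of_real field_simps)
    qed
    moreover have "(\<lambda>n. exp ((s - 1) * of_real (ln v) - of_real c * of_real v) * ((x * of_real v) ^ n /\<^sub>R fact n)) sums
       (exp ((s - 1) * of_real (ln v) - of_real c * of_real v) * exp (x * of_real v))"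
      by (intro sums_mult exp_converges)
    ultimately show ?thesis using True
      by (simp add: gamma_kernel_def mult_exp_exp x_def algebra_simps)
  next
    case False
    thus ?thesis by (simp add: f_def gamma_kernel_def)
  qed
  have normf: "norm (f n v) = norm x ^ n / fact n * norm (gamma_kernel (s + of_nat n) (of_real c) v)" for n v
    by (simp add: f_def norm_mult norm_divide norm_power)
  have "summable (\<lambda>n. norm (f n v))" for v
  proof (cases "v > 0")
    case True
    have "norm (f n v) = exp ((Re s - 1) * ln v - c * v) * ((norm x * v) ^ n /\<^sub>R fact n)" for n
    proof -
      have "exp (of_nat n * ln v) = v ^ n"
        using True by (simp add: exp_of_nat_mult)
      moreover have "(Re s + of_nat n - 1) * ln v - c * v = of_nat n * ln v + ((Re s - 1) * ln v - c * v)"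
        by (simp add: algebra_simps)
      ultimately have "exp ((Re s + of_nat n - 1) * ln v - c * v) = v ^ n * exp ((Re s - 1) * ln v - c * v)"
        by (simp only: exp_add)
      thus ?thesis
        using True by (simp add: normf norm_gamma_kernel power_mult_distrib field_simps)
    qed
    moreover have "summable (\<lambda>n. exp ((Re s - 1) * ln v - c * v) * ((norm x * v) ^ n /\<^sub>R fact n))"
      by (intro summable_mult summable_exp_generic)
    ultimately show ?thesis by simp
  next
    case False
    thus ?thesis by (simp add: f_def gamma_kernel_def)
  qed
  note fsummable = this
  \<comment> \<open>Termwise integration needs the integrals of the moduli to be summable. They form
    the binomial series with Re s and |x| in place of s and x, which converges because |x| <
    c.\<close>
  have normint: "summable (\<lambda>n. \<integral>v. norm (f n v) \<partial>lborel)"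
  proof -
    let ?s = "complex_of_real (Re s)" let ?x = "complex_of_real (norm x)"
    have eq: "complex_of_real (\<integral>v. norm (f n v) \<partial>lborel) =
       Gamma ?s * exp (- ?s * of_real (ln c)) * ((- ?s gchoose n) * (- ?x / of_real c) ^ n)" for n
    proof -
      have "complex_of_real (\<integral>v. norm (f n v) \<partial>lborel) = (\<integral>v. complex_of_real (norm (f n v)) \<partial>lborel)"
        by simp
      also have "\<dots> = (\<integral>v. ?x ^ n / fact n * gamma_kernel (?s + of_nat n) (of_real c) v \<partial>lborel)"
        unfolding normf of_real_mult of_real_norm_gamma_kernel by simp
      also have "\<dots> = ?x ^ n / fact n * (Gamma (?s + of_nat n) * exp (- (?s + of_nat n) * of_real (ln c)))"
        by (intro has_bochner_integral_integral_eq has_bochner_integral_mult_right has_bochner_integral_gamma_kernel_real)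
           (use s c in auto)
      also have "\<dots> = Gamma ?s * exp (- ?s * of_real (ln c)) * ((- ?s gchoose n) * (- ?x / of_real c) ^ n)"
        by (rule Gamma_shift_binomial_coefficient) (use s c in auto)
      finally show ?thesis .
    qed
    have "norm (- ?x / of_real c) < 1" using less c by (simp add: x_def norm_divide)
    from gen_binomial_complex[OF this, of "- ?s"]
    have "summable (\<lambda>n. complex_of_real (\<integral>v. norm (f n v) \<partial>lborel))"
      unfolding eq by (intro summable_mult) (auto simp: sums_iff)
    thus ?thesis by (simp add: summable_of_real_iff)
  qed
  have int: "integrable lborel (f n)" for n using fint has_bochner_integral_iff by blast
  have fs: "AE v in lborel. summable (\<lambda>n. norm (f n v))" using fsummable by simp
  have lim: "(\<Sum>n. f n v) = gamma_kernel s z v" for v using fsums by (simp add: sums_iff)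
  have 1: "(\<lambda>n. integral\<^sup>L lborel (f n)) sums integral\<^sup>L lborel (gamma_kernel s z)"
    using sums_integral[OF int fs normint] unfolding lim .
  have 2: "integrable lborel (gamma_kernel s z)"
    using integrable_suminf[OF int fs normint] unfolding lim .
  have "(\<lambda>n. integral\<^sup>L lborel (f n)) = (\<lambda>n. Gamma s * exp (- s * of_real (ln c)) *
          ((- s gchoose n) * (- x / of_real c) ^ n))"
    using fint Gamma_shift_binomial_coefficient[OF s c, of x] by (simp add: has_bochner_integral_iff)
  moreover have "norm (- x / of_real c) < 1" using less c by (simp add: x_def norm_divide norm_minus_commute)
  ultimately have "(\<lambda>n. integral\<^sup>L lborel (f n)) sums 
     (Gamma s * exp (- s * of_real (ln c)) * (1 + - x / of_real c) powr (- s))"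
    by (simp only:) (intro sums_mult gen_binomial_complex)
  with 1 have "integral\<^sup>L lborel (gamma_kernel s z) =
     Gamma s * exp (- s * of_real (ln c)) * (1 + - x / of_real c) powr (- s)"
    by (rule sums_unique2)
  also have "1 + - x / of_real c = z / of_real c" using c by (simp add: x_def field_simps)
  \<comment> \<open>Dividing by the positive real c leaves the argument unchanged, so the principal
    logarithm splits and the powers of c cancel.\<close>
  also have "(z / of_real c) powr (- s) = exp (- s * (Ln z - of_real (ln c)))"
    using c \<open>z \<noteq> 0\<close> by (simp add: powr_def Ln_divide_of_real)
  also have "Gamma s * exp (- s * of_real (ln c)) * \<dots> = Gamma s * exp (- s * Ln z)"
    unfolding mult.assoc mult_exp_exp by (simp add: algebra_simps)
  finally show ?thesis using 2 by (simp add: has_bochner_integral_iff)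
qed

section \<open>Gaussian integrals along a vertical line\<close>

lemma integrable_gaussian:
  fixes a :: real
  assumes "a > 0"
  shows "integrable lborel (\<lambda>y. exp (- a * y\<^sup>2))"
proof -
  have "integrable lborel (normal_density 0 (1 / sqrt (2 * a)))"
    using assms by (intro integrable_normal_density) auto
  hence "integrable lborel (\<lambda>y. sqrt (pi / a) * normal_density 0 (1 / sqrt (2 * a)) y)"
    by (rule integrable_mult_right)
  also have "(\<lambda>y. sqrt (pi / a) * normal_density 0 (1 / sqrt (2 * a)) y) = (\<lambda>y. exp (- a * y\<^sup>2))"
    using assms by (simp add: fun_eq_iff normal_density_def power_divide real_sqrt_divide field_simps)
  finally show ?thesis .
qed

text \<open>At s = k + i y the exponent is w k + \<sigma>^2 k^2 / 2 - \<sigma>^2 y^2 / 2 + i y (w +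
  \<sigma>^2 k). After rescaling by \<sigma> the integral is the standard normal characteristic
  function at \<open>\<tau>\<close>, up to the factor \<open>C\<close> over \<sigma>.\<close>

lemma has_bochner_integral_gaussian_vertical_line:
  fixes \<sigma> k w :: real
  assumes "\<sigma> > 0"
  shows "has_bochner_integral lborel
    (\<lambda>y. exp (of_real w * Complex k y + (of_real \<sigma>)\<^sup>2 / 2 * (Complex k y)\<^sup>2))
    (of_real (sqrt (2 * pi) / \<sigma> * exp (- w\<^sup>2 / (2 * \<sigma>\<^sup>2))))"
proof -
  define \<tau> where "\<tau> = (w + \<sigma>\<^sup>2 * k) / \<sigma>"
  define C where "C = sqrt (2 * pi) * exp (w * k + \<sigma>\<^sup>2 * k\<^sup>2 / 2)"
  let ?h = "\<lambda>x. std_normal_density x *\<^sub>R iexp (\<tau> * x)"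
  have "integrable lborel ?h"
    by (rule Bochner_Integration.integrable_bound[OF integrable_normal_density[of 1 0]]) auto
  moreover have "integral\<^sup>L lborel ?h = of_real (exp (- \<tau>\<^sup>2 / 2))"
    using fun_cong[OF char_std_normal_distribution, of \<tau>]
    unfolding char_def by (subst (asm) integral_density) auto
  ultimately have "has_bochner_integral lborel ?h (of_real (exp (- \<tau>\<^sup>2 / 2)))"
    by (simp add: has_bochner_integral_iff)
  hence "has_bochner_integral lborel (\<lambda>y. ?h (0 + \<sigma> * y)) (of_real (exp (- \<tau>\<^sup>2 / 2)) /\<^sub>R \<bar>\<sigma>\<bar>)"
    using assms by (subst lborel_has_bochner_integral_real_affine_iff[symmetric]) auto
  hence "has_bochner_integral lborel (\<lambda>y. of_real C * ?h (0 + \<sigma> * y))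
           (of_real C * (of_real (exp (- \<tau>\<^sup>2 / 2)) /\<^sub>R \<bar>\<sigma>\<bar>))"
    by (rule has_bochner_integral_mult_right)
  also have "(\<lambda>y. of_real C * ?h (0 + \<sigma> * y)) =
      (\<lambda>y. exp (of_real w * Complex k y + (of_real \<sigma>)\<^sup>2 / 2 * (Complex k y)\<^sup>2))"
  proof
    fix y
    have "of_real C * ?h (0 + \<sigma> * y) = exp (of_real (w * k + \<sigma>\<^sup>2 * k\<^sup>2 / 2) + of_real (- (\<sigma> * y)\<^sup>2 / 2) + \<i> * of_real (\<tau> * (\<sigma> * y)))"
      unfolding exp_add exp_of_real by (simp add: C_def normal_density_def scaleR_conv_of_real exp_add)
    also have "of_real (w * k + \<sigma>\<^sup>2 * k\<^sup>2 / 2) + of_real (- (\<sigma> * y)\<^sup>2 / 2) + \<i> * of_real (\<tau> * (\<sigma> * y)) =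
       of_real w * Complex k y + (of_real \<sigma>)\<^sup>2 / 2 * (Complex k y)\<^sup>2"
      using assms unfolding \<tau>_def
      by (simp add: complex_eq_iff power2_eq_square field_simps flip: of_real_power)
    finally show "of_real C * ?h (0 + \<sigma> * y) =
        exp (of_real w * Complex k y + (of_real \<sigma>)\<^sup>2 / 2 * (Complex k y)\<^sup>2)" .
  qed
  also have "of_real C * (complex_of_real (exp (- \<tau>\<^sup>2 / 2)) /\<^sub>R \<bar>\<sigma>\<bar>) =
      of_real (sqrt (2 * pi) / \<sigma> * exp (- w\<^sup>2 / (2 * \<sigma>\<^sup>2)))"
  proof -
    \<comment> \<open>Expanding the square of \<open>\<tau>\<close> cancels every term containing k,
      so the value is the same on all vertical lines.\<close>
    have "w * k + \<sigma>\<^sup>2 * k\<^sup>2 / 2 + (- \<tau>\<^sup>2 / 2) = - w\<^sup>2 / (2 * \<sigma>\<^sup>2)"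
      using assms unfolding \<tau>_def by (simp add: power2_eq_square field_simps)
    hence "exp (w * k + \<sigma>\<^sup>2 * k\<^sup>2 / 2) * exp (- \<tau>\<^sup>2 / 2) = exp (- w\<^sup>2 / (2 * \<sigma>\<^sup>2))"
      by (simp only: flip: exp_add)
    hence "C * (exp (- \<tau>\<^sup>2 / 2) / \<sigma>) = sqrt (2 * pi) / \<sigma> * exp (- w\<^sup>2 / (2 * \<sigma>\<^sup>2))"
      by (simp add: C_def)
    thus ?thesis using assms
      by (simp only: scaleR_conv_of_real flip: of_real_mult) (simp add: field_simps)
  qed
  finally show ?thesis .
qed

text \<open>Since Re (s^2) = k^2 - y^2, the quadratic term supplies the decay for all later
  dominations.\<close>

lemma norm_gaussian_vertical_line:
  "norm (exp (of_real w * Complex k y + (of_real \<sigma>)\<^sup>2 / 2 * (Complex k y)\<^sup>2)) =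
   exp (w * k + \<sigma>\<^sup>2 * k\<^sup>2 / 2) * exp (- (\<sigma>\<^sup>2 / 2) * y\<^sup>2)"
  by (simp add: power2_eq_square field_simps flip: exp_add of_real_power)

section \<open>The Laplace transform of the lognormal law\<close>

lemma lognormal_density_nonneg: "\<sigma> > 0 \<Longrightarrow> lognormal_density \<mu> \<sigma> x \<ge> 0"
  by (simp add: lognormal_density_def)

lemma lognormal_density_measurable [measurable]: "lognormal_density \<mu> \<sigma> \<in> borel_measurable borel"
  unfolding lognormal_density_def[abs_def] by measurable

text \<open>Fubini for the kernel times the Gaussian factor: integrating over v first yields the
  Gamma factor, integrating over y first yields the density.\<close>

lemma lognormal_laplace_transform:
  fixes \<mu> \<sigma> k :: real and z :: complex
  assumes "\<sigma> > 0" "k > 0" "Re z > 0"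
  shows "(\<integral>y. Gamma (Complex k y) * exp (- Complex k y * Ln z) *
      exp (of_real (- \<mu>) * Complex k y + (of_real \<sigma>)\<^sup>2 / 2 * (Complex k y)\<^sup>2) \<partial>lborel) =
    of_real (2 * pi) * (\<integral>v. lognormal_density \<mu> \<sigma> v *\<^sub>R exp (- z * of_real v) \<partial>lborel)"
proof -
  let ?g = "\<lambda>w y. exp (of_real w * Complex k y + (of_real \<sigma>)\<^sup>2 / 2 * (Complex k y)\<^sup>2)"
  let ?f = "\<lambda>v y. gamma_kernel (Complex k y) z v * ?g (- \<mu>) y"
  let ?C = "exp (- \<mu> * k + \<sigma>\<^sup>2 * k\<^sup>2 / 2)"
  \<comment> \<open>Re s = k is constant on the line, so the modulus splits into a function of v
    times a function of y; joint integrability reduces to the two factors.\<close>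
  have norm_f: "norm (?f v y) = norm (gamma_kernel (of_real k) z v) * (?C * exp (- (\<sigma>\<^sup>2 / 2) * y\<^sup>2))" for v y
    unfolding norm_mult norm_gaussian_vertical_line by (simp add: norm_gamma_kernel)
  have gauss: "integrable lborel (\<lambda>y. exp (- (\<sigma>\<^sup>2 / 2) * y\<^sup>2))"
    using assms by (intro integrable_gaussian) auto
  have kint: "integrable lborel (\<lambda>v. norm (gamma_kernel (of_real k) z v))"
    using has_bochner_integral_gamma_kernel[of "of_real k" z] assms by (auto simp: has_bochner_integral_iff)
  have meas [measurable]: "case_prod ?f \<in> borel_measurable (lborel \<Otimes>\<^sub>M lborel)"
    unfolding gamma_kernel_def Complex_eq by measurable
  have "integrable (lborel \<Otimes>\<^sub>M lborel) (case_prod ?f)"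
  proof (rule lborel_pair.Fubini_integrable)
    show "integrable lborel (\<lambda>v. \<integral>y. norm (case_prod ?f (v, y)) \<partial>lborel)"
      unfolding split norm_f by (simp add: kint)
    show "AE v in lborel. integrable lborel (\<lambda>y. case_prod ?f (v, y))"
    proof (rule AE_I2)
      fix v :: real
      have "integrable lborel (\<lambda>y. norm (?f v y))"
        unfolding norm_f by (intro integrable_mult_right gauss)
      thus "integrable lborel (\<lambda>y. case_prod ?f (v, y))"
        unfolding split by (subst (asm) integrable_norm_iff) measurable
    qed
  qed measurable
  hence "(\<integral>y. (\<integral>v. ?f v y \<partial>lborel) \<partial>lborel) = (\<integral>v. (\<integral>y. ?f v y \<partial>lborel) \<partial>lborel)"
    by (rule lborel_pair.Fubini_integral)
  also have "(\<lambda>y. \<integral>v. ?f v y \<partial>lborel) = (\<lambda>y. Gamma (Complex k y) * exp (- Complex k y * Ln z) * ?g (- \<mu>) y)"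
    using has_bochner_integral_gamma_kernel[of "Complex k _" z] assms by (simp add: has_bochner_integral_iff)
  also have "(\<lambda>v. \<integral>y. ?f v y \<partial>lborel) = (\<lambda>v. of_real (2 * pi) * (lognormal_density \<mu> \<sigma> v *\<^sub>R exp (- z * of_real v)))"
  proof
    fix v :: real
    show "(\<integral>y. ?f v y \<partial>lborel) = of_real (2 * pi) * (lognormal_density \<mu> \<sigma> v *\<^sub>R exp (- z * of_real v))"
    proof (cases "v > 0")
      case True
      \<comment> \<open>Write v^(s-1) as v^s / v; then v^s = e^(s ln v) merges with the Gaussian
        factor and shifts its linear coefficient to ln v - \<mu>.\<close>
      have "?f v y = exp (- z * of_real v) / of_real v * ?g (ln v - \<mu>) y" for y
      proof -
        have "1 / complex_of_real v = exp (- of_real (ln v))"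
          using True by (simp add: exp_minus exp_of_real field_simps)
        hence "exp (- z * of_real v) / of_real v * ?g (ln v - \<mu>) y = exp (- z * of_real v) * exp (- of_real (ln v)) * ?g (ln v - \<mu>) y"
          by (metis times_divide_eq_right mult.right_neutral)
        thus ?thesis
          using True by (simp add: gamma_kernel_def mult_exp_exp algebra_simps)
      qed
      hence "(\<integral>y. ?f v y \<partial>lborel) = exp (- z * of_real v) / of_real v *
          of_real (sqrt (2 * pi) / \<sigma> * exp (- (ln v - \<mu>)\<^sup>2 / (2 * \<sigma>\<^sup>2)))"
        using has_bochner_integral_gaussian_vertical_line[OF assms(1), of "ln v - \<mu>" k] by (simp add: has_bochner_integral_iff)
      also have "sqrt (2 * pi) / \<sigma> * exp (- (ln v - \<mu>)\<^sup>2 / (2 * \<sigma>\<^sup>2)) = 2 * pi * v * lognormal_density \<mu> \<sigma> v"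
      proof -
        have "2 * pi / sqrt (2 * pi) = sqrt (2 * pi)" by (simp add: real_div_sqrt)
        hence "sqrt (2 * pi) / \<sigma> = 2 * pi * (1 / (sqrt (2 * pi) * \<sigma>))"
          by (metis divide_divide_eq_left times_divide_eq_right mult.right_neutral)
        thus ?thesis using True by (simp add: lognormal_density_def)
      qed
      finally show ?thesis using True by (simp add: scaleR_conv_of_real)
    next
      case False
      thus ?thesis by (simp add: gamma_kernel_def lognormal_density_def)
    qed
  qed
  finally show ?thesis by (simp only: integral_mult_right_zero)
qed

section \<open>Bounds and the limit at the imaginary axis\<close>

text \<open>Triangle inequality for Euler's integral: the modulus of v^(s-1) depends only on Re
  s.\<close>

lemma norm_Gamma_le:
  assumes "k > 0"
  shows "norm (Gamma (Complex k y)) \<le> Gamma k"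
proof -
  have int: "has_bochner_integral lborel (gamma_kernel (Complex k y) 1) (Gamma (Complex k y))"
    "has_bochner_integral lborel (gamma_kernel (of_real k) 1) (Gamma (of_real k))"
    using assms by (auto intro!: has_bochner_integral_gamma_kernel_1)
  have "norm (Gamma (Complex k y)) \<le> (\<integral>v. norm (gamma_kernel (Complex k y) 1 v) \<partial>lborel)"
    using int(1) integral_norm_bound by (metis has_bochner_integral_integral_eq)
  moreover have "complex_of_real (\<integral>v. norm (gamma_kernel (Complex k y) 1 v) \<partial>lborel) = of_real (Gamma k)"
  proof -
    have "complex_of_real (\<integral>v. norm (gamma_kernel (Complex k y) 1 v) \<partial>lborel) =
        (\<integral>v. complex_of_real (norm (gamma_kernel (Complex k y) 1 v)) \<partial>lborel)"
      by simp
    also have "\<dots> = of_real (Gamma k)"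
      unfolding of_real_norm_gamma_kernel using int(2)
      by (simp add: has_bochner_integral_iff Gamma_complex_of_real)
    finally show ?thesis .
  qed
  hence "(\<integral>v. norm (gamma_kernel (Complex k y) 1 v) \<partial>lborel) = Gamma k"
    by (simp only: of_real_eq_iff)
  ultimately show ?thesis by simp
qed

text \<open>The point -i t has modulus |t| and principal argument -sgn(t) pi/2; this is the source
  of the linear coefficient in the final exponent.\<close>

lemma Ln_minus_ii_times:
  assumes "t \<noteq> 0"
  shows "Ln (- \<i> * of_real t) = of_real (ln \<bar>t\<bar>) - of_real (sgn t) * \<i> * (of_real pi / 2)"
proof (cases "t > 0")
  case True
  have "Ln (- \<i> * of_real t) = Ln (of_real t * (- \<i>))" by (simp add: mult.commute)
  also have "\<dots> = ln t + Ln (- \<i>)" using True by (subst Ln_times_of_real) (auto simp: Ln_of_real)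
  finally show ?thesis using True by simp
next
  case False
  have "Ln (- \<i> * of_real t) = Ln (of_real (- t) * \<i>)" by (simp add: mult.commute)
  also have "\<dots> = ln (- t) + Ln \<i>" using False assms by (subst Ln_times_of_real) (auto simp flip: Ln_of_real)
  finally show ?thesis using False assms by simp
qed

theorem corollary1:
  fixes M :: "'a measure" and X :: "'a \<Rightarrow> real" and \<mu> \<sigma> k t :: real
  defines "F \<equiv> (\<lambda>s :: complex. Gamma s *
    exp (- (of_real \<mu> + of_real (ln \<bar>t\<bar>) - of_real (sgn t) * \<i> * (of_real pi / 2)) * s
         + (of_real \<sigma>)\<^sup>2 / 2 * s\<^sup>2))"
  assumes "prob_space M" and "\<sigma> > 0" and "k > 0"
    and "lognormal_distributed M X \<mu> \<sigma>" and "t \<noteq> 0"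
  shows "vertical_line_integrable k F \<and>
    char (distr M borel X) t = 1 / (2 * of_real pi * \<i>) * vertical_line_integral k F"
proof -
  let ?\<rho> = "lognormal_density \<mu> \<sigma>"
  have dist: "distributed M lborel X (\<lambda>x. ennreal (?\<rho> x))"
    using assms by (simp add: lognormal_distributed_def)
  have "distr M borel X = distr M lborel X" by (rule distr_cong) auto
  also have "\<dots> = density lborel (\<lambda>x. ennreal (?\<rho> x))"
    using dist by (rule distributed_distr_eq_density)
  finally have law: "distr M borel X = density lborel (\<lambda>x. ennreal (?\<rho> x))" .
  \<comment> \<open>The law is a probability measure, so the density has finite mass and can serve
    as an integrable majorant.\<close>
  have "finite_measure (density lborel (\<lambda>x. ennreal (?\<rho> x)))"
    using prob_space.prob_space_distr[OF \<open>prob_space M\<close>, of X borel] distributed_measurable[OF dist]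
    unfolding law[symmetric] by (simp add: prob_space_def)
  hence "integrable (density lborel (\<lambda>x. ennreal (?\<rho> x))) (\<lambda>_. 1 :: real)"
    by (simp add: finite_measure.integrable_const)
  hence \<rho>_int: "integrable lborel ?\<rho>"
    using lognormal_density_nonneg[OF \<open>\<sigma> > 0\<close>] by (subst (asm) integrable_density) auto
  \<comment> \<open>The double minus sign exhibits the characteristic function as the Laplace
    transform at -i t.\<close>
  have char: "char (distr M borel X) t = (\<integral>x. ?\<rho> x *\<^sub>R exp (- (- \<i> * of_real t) * of_real x) \<partial>lborel)"
    unfolding char_def law using lognormal_density_nonneg[OF \<open>\<sigma> > 0\<close>]
    by (subst integral_density) (auto simp: mult_ac)

  \<comment> \<open>The imaginary part stays fixed at -t while the real part decreases to 0, which
    ensures |z n| \<ge> |t| for the bound below.\<close>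
  define z where "z n = of_real (1 / real (Suc n)) + (- \<i> * of_real t)" for n
  define L where "L = Ln (- \<i> * of_real t)"
  let ?g = "\<lambda>y. exp (of_real (- \<mu>) * Complex k y + (of_real \<sigma>)\<^sup>2 / 2 * (Complex k y)\<^sup>2)"
  let ?G = "\<lambda>l y. Gamma (Complex k y) * exp (- Complex k y * l) * ?g y"
  have z_pos: "Re (z n) > 0" for n by (simp add: z_def)
  have "(\<lambda>n. complex_of_real (1 / real (Suc n))) \<longlonglongrightarrow> of_real 0"
    by (intro tendsto_of_real LIMSEQ_Suc[OF lim_1_over_n])
  from tendsto_add[OF this tendsto_const, of "- \<i> * of_real t"]
  have z_lim: "z \<longlonglongrightarrow> - \<i> * of_real t"
    unfolding z_def[abs_def] of_real_0 add_0_left .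
  \<comment> \<open>Here t \<noteq> 0 keeps the limit point off the branch cut, where
    \<open>Ln\<close> is continuous.\<close>
  have "- \<i> * of_real t \<notin> \<real>\<^sub>\<le>\<^sub>0"
    using \<open>t \<noteq> 0\<close> by (simp add: complex_nonpos_Reals_iff)
  hence Ln_lim: "(\<lambda>n. Ln (z n)) \<longlonglongrightarrow> L"
    unfolding L_def by (intro tendsto_Ln z_lim)

  have "(\<lambda>n. \<integral>x. ?\<rho> x *\<^sub>R exp (- z n * of_real x) \<partial>lborel) \<longlonglongrightarrow>
      (\<integral>x. ?\<rho> x *\<^sub>R exp (- (- \<i> * of_real t) * of_real x) \<partial>lborel)"
  proof (rule integral_dominated_convergence[OF _ _ \<rho>_int])
    show "AE x in lborel. (\<lambda>n. ?\<rho> x *\<^sub>R exp (- z n * of_real x)) \<longlonglongrightarrow>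
        ?\<rho> x *\<^sub>R exp (- (- \<i> * of_real t) * of_real x)"
      by (intro AE_I2 tendsto_intros z_lim)
    show "AE x in lborel. norm (?\<rho> x *\<^sub>R exp (- z n * of_real x)) \<le> ?\<rho> x" for n
    proof (rule AE_I2)
      fix x :: real
      show "norm (?\<rho> x *\<^sub>R exp (- z n * of_real x)) \<le> ?\<rho> x"
      proof (cases "x > 0")
        case True
        hence "norm (exp (- z n * of_real x)) \<le> 1" using z_pos[of n] by simp
        thus ?thesis using lognormal_density_nonneg[OF \<open>\<sigma> > 0\<close>, of \<mu> x]
          by (simp add: mult_left_le)
      qed (simp add: lognormal_density_def)
    qed
  qed measurable
  hence lim1: "(\<lambda>n. \<integral>x. ?\<rho> x *\<^sub>R exp (- z n * of_real x) \<partial>lborel) \<longlonglongrightarrow> char (distr M borel X) t"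
    unfolding char .

  \<comment> \<open>A majorant independent of n: |z n| \<ge> |t| gives the power of |t|, and the
    argument contributes at most e^(pi |y|). Since pi |y| \<le> pi^2 / \<sigma>^2 + \<sigma>^2 y^2 /
    4, half of the Gaussian decay absorbs this growth and the other half remains.\<close>
  define b where "b = (\<lambda>y. Gamma k * exp (- k * ln \<bar>t\<bar>) * exp (- \<mu> * k + \<sigma>\<^sup>2 * k\<^sup>2 / 2) *
      exp (pi\<^sup>2 / \<sigma>\<^sup>2) * exp (- (\<sigma>\<^sup>2 / 4) * y\<^sup>2))"
  have b_int: "integrable lborel b"
    unfolding b_def using \<open>\<sigma> > 0\<close> by (intro integrable_mult_right integrable_gaussian) auto
  have meas_Gamma [measurable]: "(\<lambda>y. Gamma (Complex k y)) \<in> borel_measurable borel"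
  proof (intro borel_measurable_continuous_onI continuous_on_compose2[OF continuous_on_Gamma])
    show "continuous_on UNIV (Complex k)" unfolding Complex_eq by (intro continuous_intros)
    show "{s. Re s > 0} \<inter> \<int>\<^sub>\<le>\<^sub>0 = {}" by (auto elim!: nonpos_Ints_cases)
  qed (use \<open>k > 0\<close> in auto)
  have meas_G [measurable]: "?G l \<in> borel_measurable borel" for l
    unfolding Complex_eq using meas_Gamma[unfolded Complex_eq] by measurable
  have bound: "norm (?G (Ln (z n)) y) \<le> b y" for n y
  proof -
    have z0: "z n \<noteq> 0" using z_pos[of n] by auto
    have "\<bar>t\<bar> \<le> norm (z n)" using abs_Im_le_cmod[of "z n"] by (simp add: z_def)
    hence "ln \<bar>t\<bar> \<le> Re (Ln (z n))" using z0 \<open>t \<noteq> 0\<close> by (simp add: Re_Ln)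
    hence 1: "- k * Re (Ln (z n)) \<le> - k * ln \<bar>t\<bar>" using \<open>k > 0\<close> by simp
    have "\<bar>Im (Ln (z n))\<bar> \<le> pi" using mpi_less_Im_Ln[OF z0] Im_Ln_le_pi[OF z0] by linarith
    hence "\<bar>y * Im (Ln (z n))\<bar> \<le> \<bar>y\<bar> * pi" unfolding abs_mult by (intro mult_left_mono) auto
    also have "\<dots> \<le> pi\<^sup>2 / \<sigma>\<^sup>2 + \<sigma>\<^sup>2 / 4 * y\<^sup>2"
      \<comment> \<open>This is the nonnegativity of (pi / \<sigma> - \<sigma> |y| / 2)^2.\<close>
      using zero_le_power2[of "pi / \<sigma> - \<sigma> / 2 * \<bar>y\<bar>"] \<open>\<sigma> > 0\<close>
      by (simp add: power2_eq_square field_simps)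
    finally have 2: "y * Im (Ln (z n)) \<le> pi\<^sup>2 / \<sigma>\<^sup>2 + \<sigma>\<^sup>2 / 4 * y\<^sup>2" by simp
    have "norm (?G (Ln (z n)) y) = norm (Gamma (Complex k y)) * exp (- k * Re (Ln (z n)) + y * Im (Ln (z n))) *
        (exp (- \<mu> * k + \<sigma>\<^sup>2 * k\<^sup>2 / 2) * exp (- (\<sigma>\<^sup>2 / 2) * y\<^sup>2))"
      unfolding norm_mult norm_gaussian_vertical_line by simp
    also have "\<dots> \<le> Gamma k * exp (- k * ln \<bar>t\<bar> + (pi\<^sup>2 / \<sigma>\<^sup>2 + \<sigma>\<^sup>2 / 4 * y\<^sup>2)) *
        (exp (- \<mu> * k + \<sigma>\<^sup>2 * k\<^sup>2 / 2) * exp (- (\<sigma>\<^sup>2 / 2) * y\<^sup>2))"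
      using 1 2 norm_Gamma_le[OF \<open>k > 0\<close>, of y] Gamma_real_pos[OF \<open>k > 0\<close>]
      by (intro mult_mono) auto
    also have "\<dots> = b y"
      by (simp add: b_def mult_exp_exp algebra_simps)
    finally show ?thesis .
  qed
  have conv: "AE y in lborel. (\<lambda>n. ?G (Ln (z n)) y) \<longlonglongrightarrow> ?G L y"
    by (intro AE_I2 tendsto_intros Ln_lim)
  have G_int: "integrable lborel (?G L)"
    by (rule integrable_dominated_convergence[OF _ _ b_int conv])
      (simp_all only: measurable_lborel1 measurable_lborel2 meas_G bound AE_I2)
  have "(\<lambda>n. \<integral>y. ?G (Ln (z n)) y \<partial>lborel) \<longlonglongrightarrow> (\<integral>y. ?G L y \<partial>lborel)"
    by (rule integral_dominated_convergence[OF _ _ b_int conv])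
      (simp_all only: measurable_lborel1 measurable_lborel2 meas_G bound AE_I2)
  hence "(\<lambda>n. of_real (2 * pi) * (\<integral>x. ?\<rho> x *\<^sub>R exp (- z n * of_real x) \<partial>lborel)) \<longlonglongrightarrow> (\<integral>y. ?G L y \<partial>lborel)"
    unfolding lognormal_laplace_transform[OF \<open>\<sigma> > 0\<close> \<open>k > 0\<close> z_pos] .
  moreover have "(\<lambda>n. of_real (2 * pi) * (\<integral>x. ?\<rho> x *\<^sub>R exp (- z n * of_real x) \<partial>lborel)) \<longlonglongrightarrow>
      of_real (2 * pi) * char (distr M borel X) t"
    by (intro tendsto_intros lim1)
  ultimately have eq: "of_real (2 * pi) * char (distr M borel X) t = (\<integral>y. ?G L y \<partial>lborel)"
    using LIMSEQ_unique by blast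
  have F_eq: "F (Complex k y) = ?G L y" for y
    unfolding F_def L_def Ln_minus_ii_times[OF \<open>t \<noteq> 0\<close>]
    by (simp add: mult.assoc mult_exp_exp) (simp add: algebra_simps)
  \<comment> \<open>The factor i from ds = i dy cancels the i in 1 / (2 pi i).\<close>
  show ?thesis
    unfolding vertical_line_integrable_def vertical_line_integral_def F_eq eq[symmetric]
    using G_int by simp
qed

end
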